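(* For $\ell\ge 1$, let $c(\mathcal C^\circ_\ell)$ be the central arrangement in $\mathbb C^{\ell+1}$ (coordinates $x_0,x_1,\dots,x_\ell$) consisting of the hyperplanes $\{x_0=0\}$, $\{x_i-x_j+x_0=0\}$ and $\{x_i-x_j-x_0=0\}$ for $1\le i<j\le\ell$ (the cone of the semiorder arrangement). Then its Falk invariant is $\phi_3(c(\mathcal C^\circ_\ell))=\ell(\ell-1)$.
   Context: Falk invariant: for a central arrangement with hyperplanes $H_0,\dots,H_n$, $H_i=\alpha_i^{-1}(0)$, let $E$ be the exterior algebra over $\mathbb C$ on $e_0,\dots,e_n$ with degree-$p$ part $E^p$, and $\partial$ the degree $-1$ derivation with $\partial e_i=1$. A subset $S$ is dependent if $\{\alpha_i:i\in S\}$ is linearly dependent. The Orlik–Solomon ideal $I$ is generated by $\partial e_S$ for $S$ dependent ($e_S$ the ordered wedge of $e_i$, $i\in S$), $I^p=I\cap E^p$, and $\phi_3=\dim\ker(E^1\otimes I^2\to E^3,\ a\otimes b\mapsto a\wedge b)$. *)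

theory Defs
  imports Complex_Main "HOL-Library.Function_Algebras"
begin

definition cscale :: "complex \<Rightarrow> ('a \<Rightarrow> complex) \<Rightarrow> 'a \<Rightarrow> complex" where
  "cscale c f = (\<lambda>x. c * f x)"

global_interpretation cfun: vector_space "cscale :: complex \<Rightarrow> ('a \<Rightarrow> complex) \<Rightarrow> 'a \<Rightarrow> complex"
  by unfold_locales (auto simp: cscale_def fun_eq_iff algebra_simps)

section \<open>Central arrangements\<close>

text \<open>The space of \<open>d\<close>-tuples of complex numbers is modelled by the functions vanishing from
  index \<open>d\<close> on; a linear form on it is given by its vector of coefficients.\<close>

definition coord_space :: "nat \<Rightarrow> (nat \<Rightarrow> complex) set" where
  "coord_space d = {x. \<forall>k\<ge>d. x k = 0}"

definition hyperplane :: "nat \<Rightarrow> (nat \<Rightarrow> complex) \<Rightarrow> (nat \<Rightarrow> complex) set" where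
  "hyperplane d a = {x \<in> coord_space d. (\<Sum>k<d. a k * x k) = 0}"

definition defining_forms ::
  "nat \<Rightarrow> nat \<Rightarrow> (nat \<Rightarrow> nat \<Rightarrow> complex) \<Rightarrow> (nat \<Rightarrow> complex) set set \<Rightarrow> bool" where
  "defining_forms d n \<alpha> \<A> \<longleftrightarrow>
     (\<forall>i\<le>n. \<alpha> i \<in> coord_space d \<and> \<alpha> i \<noteq> 0) \<and>
     bij_betw (\<lambda>i. hyperplane d (\<alpha> i)) {..n} \<A>"

definition semiorder_cone :: "nat \<Rightarrow> (nat \<Rightarrow> complex) set set" where
  "semiorder_cone l =
     {{x \<in> coord_space (l + 1). x 0 = 0}} \<union>
     {{x \<in> coord_space (l + 1). x i - x j + x 0 = 0} |i j. 1 \<le> i \<and> i < j \<and> j \<le> l} \<union>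
     {{x \<in> coord_space (l + 1). x i - x j - x 0 = 0} |i j. 1 \<le> i \<and> i < j \<and> j \<le> l}"

lemma semiorder_cone_hyperplane:
  assumes "H \<in> semiorder_cone l"
  shows "\<exists>a. a \<in> coord_space (l + 1) \<and> a \<noteq> 0 \<and> H = hyperplane (l + 1) a"
proof -
  have *: "\<exists>a. a \<in> coord_space (l + 1) \<and> a \<noteq> 0 \<and>
      {x \<in> coord_space (l + 1). x i - x j + c * x 0 = 0} = hyperplane (l + 1) a"
    if ij: "1 \<le> i" "i < j" "j \<le> l" for i j and c :: complex
  proof -
    define a :: "nat \<Rightarrow> complex" where
      "a = (\<lambda>k. (if k = i then 1 else 0) + (if k = j then - 1 else 0) + (if k = 0 then c else 0))"
    have "(\<Sum>k<l + 1. a k * x k) = x i - x j + c * x 0" for x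
    proof -
      have "(\<Sum>k<l + 1. a k * x k) = (\<Sum>k<l + 1. if k = i then x i else 0)
          + (\<Sum>k<l + 1. if k = j then - x j else 0) + (\<Sum>k<l + 1. if k = 0 then c * x 0 else 0)"
        unfolding sum.distrib[symmetric]
        by (rule sum.cong) (auto simp: a_def algebra_simps)
      also have "\<dots> = x i - x j + c * x 0" using ij by (simp add: less_Suc_eq_le del: sum.lessThan_Suc)
      finally show ?thesis .
    qed
    moreover have "a i = 1" using ij by (auto simp: a_def)
    then have "a \<noteq> 0" by auto
    moreover have "a \<in> coord_space (l + 1)" using ij by (auto simp: a_def coord_space_def)
    ultimately show ?thesis unfolding hyperplane_def by (intro exI[of _ a]) simp
  qed
  define e :: "nat \<Rightarrow> complex" where "e = (\<lambda>k. if k = 0 then 1 else 0)"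
  have "(\<Sum>k<l + 1. e k * x k) = x 0" for x
  proof -
    have "(\<Sum>k<l + 1. e k * x k) = (\<Sum>k<l + 1. if k = 0 then x 0 else 0)"
      by (rule sum.cong) (auto simp: e_def)
    then show ?thesis by (simp del: sum.lessThan_Suc)
  qed
  moreover have "e 0 = 1" by (simp add: e_def)
  then have "e \<noteq> 0" by auto
  moreover have "e \<in> coord_space (l + 1)" by (auto simp: e_def coord_space_def)
  ultimately have "\<exists>a. a \<in> coord_space (l + 1) \<and> a \<noteq> 0 \<and>
      {x \<in> coord_space (l + 1). x 0 = 0} = hyperplane (l + 1) a"
    unfolding hyperplane_def by (intro exI[of _ e]) simp
  then show ?thesis
    using assms *[of _ _ 1] *[of _ _ "- 1"] unfolding semiorder_cone_def by auto
qed

lemma defining_forms_semiorder_cone_exist: "\<exists>n \<alpha>. defining_forms (l + 1) n \<alpha> (semiorder_cone l)"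
proof -
  let ?A = "semiorder_cone l"
  have "?A \<subseteq> {{x \<in> coord_space (l + 1). x 0 = 0}} \<union>
      (\<lambda>(i, j). {x \<in> coord_space (l + 1). x i - x j + x 0 = 0}) ` ({..l} \<times> {..l}) \<union>
      (\<lambda>(i, j). {x \<in> coord_space (l + 1). x i - x j - x 0 = 0}) ` ({..l} \<times> {..l})"
    unfolding semiorder_cone_def by fastforce
  then have fin: "finite ?A" by (rule finite_subset) auto
  moreover have "?A \<noteq> {}" by (auto simp: semiorder_cone_def)
  ultimately obtain n where n: "card ?A = Suc n" by (metis card_0_eq not0_implies_Suc)
  have "\<exists>h. bij_betw h {..n} ?A"
    using ex_bij_betw_nat_finite[OF fin] by (simp add: n atLeast0LessThan lessThan_Suc_atMost)
  then obtain h where h: "bij_betw h {..n} ?A" ..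
  have "\<forall>i\<in>{..n}. \<exists>a. a \<in> coord_space (l + 1) \<and> a \<noteq> 0 \<and> h i = hyperplane (l + 1) a"
    using h semiorder_cone_hyperplane by (meson bij_betwE)
  then obtain \<alpha> where \<alpha>: "\<forall>i\<in>{..n}. \<alpha> i \<in> coord_space (l + 1) \<and> \<alpha> i \<noteq> 0 \<and>
      h i = hyperplane (l + 1) (\<alpha> i)"
    by metis
  have "bij_betw (\<lambda>i. hyperplane (l + 1) (\<alpha> i)) {..n} ?A"
    using h by (rule bij_betw_cong[THEN iffD1, rotated]) (use \<alpha> in auto)
  then have "defining_forms (l + 1) n \<alpha> ?A"
    using \<alpha> by (auto simp: defining_forms_def)
  then show ?thesis by blast
qed

section \<open>The exterior algebra\<close>

text \<open>An element of the exterior algebra on \<open>e\<^sub>0, \<dots>, e\<^sub>n\<close> is given by its coefficients in the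
  basis of the ordered wedges \<open>e\<^sub>S\<close>, where \<open>S\<close> ranges over the subsets of \<open>{..n}\<close>.\<close>

type_synonym ext = "nat set \<Rightarrow> complex"

definition ext_alg :: "nat \<Rightarrow> ext set" where
  "ext_alg n = {a. \<forall>S. a S \<noteq> 0 \<longrightarrow> S \<subseteq> {..n}}"

definition ext_deg :: "nat \<Rightarrow> nat \<Rightarrow> ext set" where
  "ext_deg n p = {a \<in> ext_alg n. \<forall>S. a S \<noteq> 0 \<longrightarrow> card S = p}"

definition ext_basis :: "nat set \<Rightarrow> ext" where
  "ext_basis S = (\<lambda>T. if T = S then 1 else 0)"

text \<open>For disjoint \<open>S\<close> and \<open>T\<close>, this is the sign with \<open>e\<^sub>S \<and> e\<^sub>T = \<plusminus> e\<^bsub>S \<union> T\<^esub>\<close>.\<close>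

definition shuffle_sign :: "nat set \<Rightarrow> nat set \<Rightarrow> complex" where
  "shuffle_sign S T = (- 1) ^ card {(s, t). s \<in> S \<and> t \<in> T \<and> t < s}"

definition wedge :: "ext \<Rightarrow> ext \<Rightarrow> ext" where
  "wedge a b = (\<lambda>U. \<Sum>S\<in>Pow U. shuffle_sign S (U - S) * a S * b (U - S))"

text \<open>The derivation with \<open>\<partial> e\<^sub>i = 1\<close>, in coordinates: for \<open>S = {s\<^sub>0 < \<dots> < s\<^sub>p}\<close> it maps \<open>e\<^sub>S\<close> to the
  sum of the \<open>(- 1)\<^sup>k e\<^bsub>S - {s\<^sub>k}\<^esub>\<close>. It is determined by linearity, \<open>ext_diff_one\<close> and
  \<open>ext_diff_wedge_generator\<close> below.\<close>

definition ext_diff :: "nat \<Rightarrow> ext \<Rightarrow> ext" where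
  "ext_diff n a = (\<lambda>T. \<Sum>i\<in>{..n} - T. (- 1) ^ card {j \<in> T. j < i} * a (insert i T))"

lemma wedge_generator:
  assumes "finite U"
  shows "wedge (ext_basis {i}) b U =
    (if i \<in> U then (- 1) ^ card {j \<in> U. j < i} * b (U - {i}) else 0)"
proof -
  have *: "wedge (ext_basis {i}) b U =
      (\<Sum>S\<in>Pow U. if S = {i} then shuffle_sign {i} (U - {i}) * b (U - {i}) else 0)"
    unfolding wedge_def ext_basis_def by (intro sum.cong) auto
  have "{(s, t). s \<in> {i} \<and> t \<in> U - {i} \<and> t < s} = Pair i ` {j \<in> U. j < i}"
    by auto
  then have "shuffle_sign {i} (U - {i}) = (- 1) ^ card {j \<in> U. j < i}"
    by (simp add: shuffle_sign_def card_image inj_on_def)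
  then show ?thesis
    unfolding * using assms by simp
qed

lemma wedge_infinite: "infinite U \<Longrightarrow> wedge a b U = 0"
  by (simp add: wedge_def finite_Pow_iff)

lemma ext_basis_insert:
  assumes "finite S" and "\<And>j. j \<in> S \<Longrightarrow> i < j"
  shows "ext_basis (insert i S) = wedge (ext_basis {i}) (ext_basis S)"
proof
  fix U
  have "i \<notin> S" using assms(2) by blast
  show "ext_basis (insert i S) U = wedge (ext_basis {i}) (ext_basis S) U"
  proof (cases "finite U")
    case False
    then show ?thesis using assms(1) by (auto simp: wedge_infinite ext_basis_def)
  next
    case True
    have *: "{j \<in> insert i S. j < i} = {}" using assms(2) by fastforce
    show ?thesis
    proof (cases "U = insert i S")
      case True
      have "insert i S - {i} = S" using \<open>i \<notin> S\<close> by auto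
      then show ?thesis
        unfolding True wedge_generator[OF finite.insertI[OF assms(1)]] *
        by (simp add: ext_basis_def)
    next
      case False
      then have "i \<in> U \<Longrightarrow> U - {i} \<noteq> S" by auto
      then show ?thesis
        unfolding wedge_generator[OF \<open>finite U\<close>] using False by (simp add: ext_basis_def)
    qed
  qed
qed

lemma ext_diff_one: "ext_diff n (ext_basis {}) = 0"
  by (auto simp: ext_diff_def ext_basis_def fun_eq_iff)

lemma ext_diff_generator:
  assumes "i \<le> n"
  shows "ext_diff n (ext_basis {i}) = ext_basis {}"
proof
  fix T
  have "insert j T = {i} \<longleftrightarrow> j = i \<and> T = {}" if "j \<notin> T" for j
    using that by auto
  then have "ext_diff n (ext_basis {i}) T =
      (\<Sum>j\<in>{..n} - T. if j = i then (if T = {} then 1 else 0) else 0)"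
    unfolding ext_diff_def ext_basis_def by (intro sum.cong) auto
  then show "ext_diff n (ext_basis {i}) T = ext_basis {} T"
    using assms by (auto simp: ext_basis_def)
qed

lemma ext_diff_wedge_generator:
  assumes "i \<le> n" and "b \<in> ext_alg n"
  shows "ext_diff n (wedge (ext_basis {i}) b) = b - wedge (ext_basis {i}) (ext_diff n b)"
proof
  fix T
  show "ext_diff n (wedge (ext_basis {i}) b) T = (b - wedge (ext_basis {i}) (ext_diff n b)) T"
  proof (cases "finite T")
    case False
    then have "b T = 0" using assms(2) finite_subset[of T "{..n}"] by (auto simp: ext_alg_def)
    with False show ?thesis by (simp add: wedge_infinite ext_diff_def)
  next
    case fin: True
    show ?thesis
    proof (cases "i \<in> T")
      case False
      have "ext_diff n (wedge (ext_basis {i}) b) T = (\<Sum>j\<in>{..n} - T. if j = i then b T else 0)"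
        unfolding ext_diff_def
      proof (intro sum.cong refl)
        fix j assume "j \<in> {..n} - T"
        have "{k \<in> insert i T. k < i} = {k \<in> T. k < i}" by auto
        then show "(- 1) ^ card {k \<in> T. k < j} * wedge (ext_basis {i}) b (insert j T) =
            (if j = i then b T else 0)"
          using False fin by (auto simp: wedge_generator simp flip: power_add mult_2)
      qed
      then show ?thesis using False fin assms(1) by (simp add: wedge_generator)
    next
      case True
      define R where "R = T - {i}"
      have R: "T = insert i R" "i \<notin> R" "finite R" using True fin by (auto simp: R_def)
      let ?s = "\<lambda>A k. (- 1) ^ card {j \<in> A. j < k} :: complex"
      have sT: "?s T i * ?s R i = 1"
      proof -
        have "{j \<in> T. j < i} = {j \<in> R. j < i}" using R by auto
        then show ?thesis by (simp flip: power_add mult_2)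
      qed
      have summand: "?s T j * wedge (ext_basis {i}) b (insert j T) =
          - (?s T i * (?s R j * b (insert j R)))"
        if j: "j \<in> {..n} - T" for j
      proof -
        have ji: "j \<noteq> i" "j \<notin> R" using j R by auto
        have "insert j T - {i} = insert j R" using R ji by auto
        then have w: "wedge (ext_basis {i}) b (insert j T) = ?s (insert j T) i * b (insert j R)"
          using R fin by (simp add: wedge_generator)
        have sgn: "?s T j * ?s (insert j T) i = - (?s T i * ?s R j)"
        proof (cases "j < i")
          case True
          have "{k \<in> T. k < j} = {k \<in> R. k < j}" using R True by auto
          moreover have "{k \<in> insert j T. k < i} = insert j {k \<in> T. k < i}" using True by auto
          ultimately show ?thesis using j fin by simp
        next
          case False
          then have "i < j" using ji by simp
          have "{k \<in> T. k < j} = insert i {k \<in> R. k < j}" using R \<open>i < j\<close> by auto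
          moreover have "{k \<in> insert j T. k < i} = {k \<in> T. k < i}" using \<open>i < j\<close> by auto
          ultimately show ?thesis using R by simp
        qed
        show ?thesis
          unfolding w using arg_cong[OF sgn, of "\<lambda>z. z * b (insert j R)"] by (simp add: mult.assoc)
      qed
      have split: "{..n} - R = insert i ({..n} - T)" "i \<notin> {..n} - T" using R assms(1) by auto
      have "wedge (ext_basis {i}) (ext_diff n b) T = ?s T i * ext_diff n b R"
        using True fin by (simp add: wedge_generator R_def)
      also have "ext_diff n b R = ?s R i * b T + (\<Sum>j\<in>{..n} - T. ?s R j * b (insert j R))"
        unfolding ext_diff_def split(1) using split(2) R(1) by simp
      also have "?s T i * \<dots> = b T + (\<Sum>j\<in>{..n} - T. ?s T i * (?s R j * b (insert j R)))"
        using sT by (simp add: distrib_left sum_distrib_left mult.assoc[symmetric])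
      finally have r: "wedge (ext_basis {i}) (ext_diff n b) T = \<dots>" .
      have "ext_diff n (wedge (ext_basis {i}) b) T =
          (\<Sum>j\<in>{..n} - T. - (?s T i * (?s R j * b (insert j R))))"
        unfolding ext_diff_def by (intro sum.cong refl summand)
      then show ?thesis by (simp add: r sum_negf)
    qed
  qed
qed

section \<open>The Orlik--Solomon ideal and the Falk invariant\<close>

definition ext_ideal :: "nat \<Rightarrow> ext set \<Rightarrow> bool" where
  "ext_ideal n J \<longleftrightarrow> J \<subseteq> ext_alg n \<and> cfun.subspace J \<and>
     (\<forall>a\<in>ext_alg n. \<forall>b\<in>J. wedge a b \<in> J \<and> wedge b a \<in> J)"

definition os_ideal :: "nat \<Rightarrow> (nat \<Rightarrow> nat \<Rightarrow> complex) \<Rightarrow> ext set" where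
  "os_ideal n \<alpha> =
     ext_ideal n hull {ext_diff n (ext_basis S) |S. S \<subseteq> {..n} \<and> cfun.dependent (\<alpha> ` S)}"

definition os_ideal_deg :: "nat \<Rightarrow> (nat \<Rightarrow> nat \<Rightarrow> complex) \<Rightarrow> nat \<Rightarrow> ext set" where
  "os_ideal_deg n \<alpha> p = os_ideal n \<alpha> \<inter> ext_deg n p"

text \<open>Over a field, the tensor product of two spaces of functions on \<open>A\<close> and on \<open>B\<close> embeds into
  the functions on \<open>A \<times> B\<close>, and is the span there of the products \<open>v \<otimes> w\<close>.\<close>

definition pure_tensor :: "('a \<Rightarrow> complex) \<Rightarrow> ('b \<Rightarrow> complex) \<Rightarrow> 'a \<times> 'b \<Rightarrow> complex" where
  "pure_tensor v w = (\<lambda>(x, y). v x * w y)"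

definition tensor_product ::
  "('a \<Rightarrow> complex) set \<Rightarrow> ('b \<Rightarrow> complex) set \<Rightarrow> ('a \<times> 'b \<Rightarrow> complex) set" where
  "tensor_product V W = cfun.span {pure_tensor v w |v w. v \<in> V \<and> w \<in> W}"

text \<open>The linear map with \<open>a \<otimes> b \<mapsto> a \<and> b\<close>.\<close>

definition wedge_map :: "(nat set \<times> nat set \<Rightarrow> complex) \<Rightarrow> ext" where
  "wedge_map t = (\<lambda>U. \<Sum>S\<in>Pow U. shuffle_sign S (U - S) * t (S, U - S))"

lemma wedge_map_pure_tensor: "wedge_map (pure_tensor a b) = wedge a b"
  by (simp add: wedge_map_def wedge_def pure_tensor_def mult.assoc)

lemma wedge_map_add: "wedge_map (s + t) = wedge_map s + wedge_map t"
  by (simp add: wedge_map_def fun_eq_iff distrib_left sum.distrib)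

lemma wedge_map_scale: "wedge_map (cscale c t) = cscale c (wedge_map t)"
  by (simp add: wedge_map_def cscale_def sum_distrib_left mult.left_commute)

definition falk_invariant :: "nat \<Rightarrow> (nat \<Rightarrow> nat \<Rightarrow> complex) \<Rightarrow> nat" where
  "falk_invariant n \<alpha> =
     cfun.dim {t \<in> tensor_product (ext_deg n 1) (os_ideal_deg n \<alpha> 2). wedge_map t = 0}"

end

theory Submission
  imports Defs
begin

text \<open>Up to scalars, the forms of the arrangement are \<open>x\<^sub>0\<close> and \<open>f\<^sub>i\<^sub>j = x\<^sub>i - x\<^sub>j - x\<^sub>0\<close> for ordered pairs
  \<open>i \<noteq> j\<close>, and the only dependent sets of at most three of them are the triples \<open>{x\<^sub>0, f\<^sub>i\<^sub>j, f\<^sub>j\<^sub>i}\<close>.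
  So \<open>I\<^sup>2\<close> is spanned by the products \<open>g\<^sub>p = (e\<^sub>a - e\<^sub>z) \<and> (e\<^sub>b - e\<^sub>z)\<close>, where \<open>z\<close> is the index of \<open>x\<^sub>0\<close>
  and \<open>p = {a, b}\<close> runs through disjoint pairs of indices. Disjointness makes the products
  \<open>e\<^sub>c \<and> g\<^sub>p\<close> with \<open>c \<notin> p\<close> linearly independent, so the kernel has the basis
  \<open>(e\<^sub>a - e\<^sub>z) \<otimes> g\<^sub>p\<close> with \<open>a \<in> p\<close>, one element for each hyperplane other than \<open>x\<^sub>0 = 0\<close>.\<close>

section \<open>Linear combinations, independence and tensors of complex-valued functions\<close>

lemma sum_fun_apply: "sum f A x = (\<Sum>i\<in>A. f i x)" for f :: "'i \<Rightarrow> 'a \<Rightarrow> complex"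
  by (induction A rule: infinite_finite_induct) auto

lemma sum_cscale_apply: "(\<Sum>i\<in>A. cscale (c i) (f i)) x = (\<Sum>i\<in>A. c i * f i x)"
  by (simp add: sum_fun_apply cscale_def)

text \<open>Coefficients are indexed by \<open>X\<close> and not by the vectors, so that they can
  later be determined label by label.\<close>

lemma span_image_combination:
  assumes "finite X" and "t \<in> cfun.span (h ` X)"
  shows "\<exists>c. t = (\<Sum>x\<in>X. cscale (c x) (h x))"
proof -
  have "cfun.subspace {t. \<exists>c. t = (\<Sum>x\<in>X. cscale (c x) (h x))}"
  proof (rule cfun.subspaceI; clarify)
    show "\<exists>c. 0 = (\<Sum>x\<in>X. cscale (c x) (h x))"
      by (rule exI[of _ "\<lambda>_. 0"]) simp
  next
    fix c d
    show "\<exists>e. (\<Sum>x\<in>X. cscale (c x) (h x)) + (\<Sum>x\<in>X. cscale (d x) (h x)) =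
        (\<Sum>x\<in>X. cscale (e x) (h x))"
      by (rule exI[of _ "\<lambda>x. c x + d x"]) (simp add: cfun.scale_left_distrib sum.distrib)
  next
    fix k c
    show "\<exists>e. cscale k (\<Sum>x\<in>X. cscale (c x) (h x)) = (\<Sum>x\<in>X. cscale (e x) (h x))"
      by (rule exI[of _ "\<lambda>x. k * c x"]) (simp add: cfun.scale_sum_right)
  qed
  moreover have "h y = (\<Sum>x\<in>X. cscale (if x = y then 1 else 0) (h x))" if "y \<in> X" for y
  proof -
    have "(\<Sum>x\<in>X. cscale (if x = y then 1 else 0) (h x)) = (\<Sum>x\<in>X. if x = y then h y else 0)"
      by (rule sum.cong) auto
    then show ?thesis using assms(1) that by simp
  qed
  then have "h ` X \<subseteq> {t. \<exists>c. t = (\<Sum>x\<in>X. cscale (c x) (h x))}"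
    by (intro image_subsetI CollectI exI)
  ultimately show ?thesis
    using cfun.span_minimal assms(2) by blast
qed

text \<open>Evaluation at the points \<open>y x\<close> gives a diagonal matrix with nonzero
  diagonal: at \<open>y x\<close> a linear relation keeps only the term of \<open>x\<close>.\<close>

lemma independent_image_dual_points:
  assumes "finite X"
    and diag: "\<And>x. x \<in> X \<Longrightarrow> h x (y x) \<noteq> 0"
    and off: "\<And>x x'. x \<in> X \<Longrightarrow> x' \<in> X \<Longrightarrow> x' \<noteq> x \<Longrightarrow> h x' (y x) = 0"
  shows "inj_on h X" and "cfun.independent (h ` X)"
proof -
  show inj: "inj_on h X"
    using diag off by (metis inj_onI)
  show "cfun.independent (h ` X)"
  proof
    assume "cfun.dependent (h ` X)"
    then obtain u where u: "\<exists>v\<in>h ` X. u v \<noteq> 0" "(\<Sum>v\<in>h ` X. cscale (u v) v) = 0"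
      using assms(1) by (auto simp: cfun.dependent_finite)
    then obtain x where x: "x \<in> X" "u (h x) \<noteq> 0" by auto
    have "0 = (\<Sum>w\<in>X. cscale (u (h w)) (h w)) (y x)"
      using u(2) inj by (simp add: sum.reindex)
    also have "\<dots> = (\<Sum>w\<in>X. if w = x then u (h x) * h x (y x) else 0)"
      unfolding sum_cscale_apply using off x(1) by (intro sum.cong) auto
    also have "\<dots> = u (h x) * h x (y x)"
      using assms(1) x(1) by simp
    finally show False using diag x by auto
  qed
qed

text \<open>By bilinearity, one slot at a time: first \<open>w\<close> varies with a generator on
  the left, then \<open>v\<close> varies with \<open>w\<close> fixed. This turns spanning sets of
  two spaces into one of their tensor product.\<close>

lemma pure_tensor_in_span:
  assumes "v \<in> cfun.span A" and "w \<in> cfun.span B"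
  shows "pure_tensor v w \<in> cfun.span {pure_tensor a b |a b. a \<in> A \<and> b \<in> B}"
    (is "_ \<in> cfun.span ?G")
proof -
  have left: "pure_tensor a w \<in> cfun.span ?G" if "a \<in> A" for a
  proof -
    have "cfun.subspace {w. pure_tensor a w \<in> cfun.span ?G}"
    proof (rule cfun.subspaceI; clarify)
      have "pure_tensor a (0 :: 'b \<Rightarrow> complex) = 0" by (auto simp: pure_tensor_def)
      then show "pure_tensor a 0 \<in> cfun.span ?G" by (simp add: cfun.span_zero)
    next
      fix x y
      assume "pure_tensor a x \<in> cfun.span ?G" "pure_tensor a y \<in> cfun.span ?G"
      moreover have "pure_tensor a (x + y) = pure_tensor a x + pure_tensor a y"
        by (auto simp: pure_tensor_def algebra_simps)
      ultimately show "pure_tensor a (x + y) \<in> cfun.span ?G" by (simp add: cfun.span_add)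
    next
      fix c x
      assume "pure_tensor a x \<in> cfun.span ?G"
      moreover have "pure_tensor a (cscale c x) = cscale c (pure_tensor a x)"
        by (auto simp: pure_tensor_def cscale_def)
      ultimately show "pure_tensor a (cscale c x) \<in> cfun.span ?G" by (simp add: cfun.span_scale)
    qed
    moreover have "B \<subseteq> {w. pure_tensor a w \<in> cfun.span ?G}"
      using that by (auto intro!: cfun.span_base)
    ultimately show ?thesis using cfun.span_minimal assms(2) by blast
  qed
  have "cfun.subspace {v. pure_tensor v w \<in> cfun.span ?G}"
  proof (rule cfun.subspaceI; clarify)
    have "pure_tensor (0 :: 'a \<Rightarrow> complex) w = 0" by (auto simp: pure_tensor_def)
    then show "pure_tensor 0 w \<in> cfun.span ?G" by (simp add: cfun.span_zero)
  next
    fix x y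
    assume "pure_tensor x w \<in> cfun.span ?G" "pure_tensor y w \<in> cfun.span ?G"
    moreover have "pure_tensor (x + y) w = pure_tensor x w + pure_tensor y w"
      by (auto simp: pure_tensor_def algebra_simps)
    ultimately show "pure_tensor (x + y) w \<in> cfun.span ?G" by (simp add: cfun.span_add)
  next
    fix c x
    assume "pure_tensor x w \<in> cfun.span ?G"
    moreover have "pure_tensor (cscale c x) w = cscale c (pure_tensor x w)"
      by (auto simp: pure_tensor_def cscale_def)
    ultimately show "pure_tensor (cscale c x) w \<in> cfun.span ?G" by (simp add: cfun.span_scale)
  qed
  moreover have "A \<subseteq> {v. pure_tensor v w \<in> cfun.span ?G}" using left by auto
  ultimately show ?thesis using cfun.span_minimal assms(1) by blast
qed

lemma wedge_map_combination:
  "wedge_map (\<Sum>x\<in>X. cscale (c x) (h x)) = (\<Sum>x\<in>X. cscale (c x) (wedge_map (h x)))"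
proof (induction X rule: infinite_finite_induct)
  case (insert x F)
  then show ?case by (simp add: wedge_map_add wedge_map_scale del: plus_fun_apply)
qed (auto simp: wedge_map_def fun_eq_iff)

section \<open>Degrees and the derivation on basis wedges\<close>

lemma ext_deg_one_span: "ext_deg n 1 \<subseteq> cfun.span ((\<lambda>i. ext_basis {i}) ` {..n})"
proof
  fix v assume v: "v \<in> ext_deg n 1"
  have "v = (\<Sum>i\<le>n. cscale (v {i}) (ext_basis {i}))"
  proof
    fix S
    show "v S = (\<Sum>i\<le>n. cscale (v {i}) (ext_basis {i})) S"
    proof (cases "\<exists>i\<le>n. S = {i}")
      case True
      then obtain i where i: "i \<le> n" "S = {i}" by blast
      have "(\<Sum>j\<le>n. v {j} * ext_basis {j} S) = (\<Sum>j\<le>n. if j = i then v {i} else 0)"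
        by (rule sum.cong) (auto simp: ext_basis_def i)
      then show ?thesis using i by (simp add: sum_cscale_apply)
    next
      case False
      then have "v S = 0"
        using v by (force simp: ext_deg_def ext_alg_def card_1_singleton_iff)
      moreover have "(\<Sum>j\<le>n. v {j} * ext_basis {j} S) = 0"
        using False by (intro sum.neutral) (auto simp: ext_basis_def)
      ultimately show ?thesis by (simp add: sum_cscale_apply)
    qed
  qed
  also have "\<dots> \<in> cfun.span ((\<lambda>i. ext_basis {i}) ` {..n})"
    by (intro cfun.span_sum cfun.span_scale cfun.span_base) auto
  finally show "v \<in> cfun.span ((\<lambda>i. ext_basis {i}) ` {..n})" .
qed

lemma ext_basis_in_ext_alg: "S \<subseteq> {..n} \<Longrightarrow> ext_basis S \<in> ext_alg n"
  by (auto simp: ext_basis_def ext_alg_def)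

lemma ext_diff_basis_in_ext_deg:
  assumes "S \<subseteq> {..n}" and "card S = Suc p"
  shows "ext_diff n (ext_basis S) \<in> ext_deg n p"
proof -
  have "T \<subseteq> {..n} \<and> card T = p" if "ext_diff n (ext_basis S) T \<noteq> 0" for T
  proof -
    have "\<exists>i\<in>{..n} - T. insert i T = S"
    proof (rule ccontr)
      assume "\<not> ?thesis"
      then have "ext_diff n (ext_basis S) T = 0"
        unfolding ext_diff_def by (intro sum.neutral ballI) (auto simp: ext_basis_def)
      with that show False by simp
    qed
    then obtain i where i: "i \<in> {..n} - T" "insert i T = S" by blast
    moreover have "finite T" using i assms finite_subset[of S "{..n}"] by auto
    ultimately show ?thesis using assms by auto
  qed
  then show ?thesis by (auto simp: ext_deg_def ext_alg_def)
qed

lemma wedge_generator_basis_same: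
  assumes "i \<in> S"
  shows "wedge (ext_basis {i}) (ext_basis S) = 0"
proof
  fix U
  show "wedge (ext_basis {i}) (ext_basis S) U = 0 U"
    using assms by (cases "finite U") (auto simp: wedge_generator wedge_infinite ext_basis_def[of S])
qed

text \<open>Apply the derivation to \<open>e\<^sub>i \<and> e\<^sub>S = 0\<close>. The result does
  not depend on \<open>i \<in> S\<close>, which is the source of all kernel elements found
  below.\<close>

lemma wedge_generator_ext_diff_basis:
  assumes "S \<subseteq> {..n}" and "i \<in> S"
  shows "wedge (ext_basis {i}) (ext_diff n (ext_basis S)) = ext_basis S"
proof -
  have "ext_diff n (0 :: ext) = 0" by (auto simp: ext_diff_def)
  then show ?thesis
    using ext_diff_wedge_generator[of i n "ext_basis S"] assms
    by (auto simp: wedge_generator_basis_same ext_basis_in_ext_alg subset_iff)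
qed

text \<open>A term of the boundary avoids \<open>z\<close> only if \<open>z\<close> is the removed
  index; the sign records the position of \<open>z\<close>. So the coefficients at sets without
  \<open>z\<close> recover \<open>p\<close>.\<close>

lemma ext_diff_basis_insert:
  assumes "z \<le> n" and "z \<notin> p" and "z \<notin> T"
  shows "ext_diff n (ext_basis (insert z p)) T = (if T = p then (- 1) ^ card {j \<in> p. j < z} else 0)"
proof -
  have *: "insert i T = insert z p \<longleftrightarrow> i = z \<and> T = p" if "i \<notin> T" for i
    using assms that by (metis insertE insertI1 insert_ident)
  have "ext_diff n (ext_basis (insert z p)) T =
      (\<Sum>i\<in>{..n} - T. if i = z then (if T = p then (- 1) ^ card {j \<in> p. j < z} else 0) else 0)"
    unfolding ext_diff_def by (rule sum.cong) (auto simp: * ext_basis_def)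
  then show ?thesis using assms by simp
qed

lemma wedge_in_ext_alg:
  assumes "a \<in> ext_alg n" and "b \<in> ext_alg n"
  shows "wedge a b \<in> ext_alg n"
proof -
  have "wedge a b U = 0" if U: "\<not> U \<subseteq> {..n}" for U
    unfolding wedge_def
  proof (intro sum.neutral ballI)
    fix S assume "S \<in> Pow U"
    then have "\<not> S \<subseteq> {..n} \<or> \<not> U - S \<subseteq> {..n}" using U by blast
    then show "shuffle_sign S (U - S) * a S * b (U - S) = 0"
      using assms by (auto simp: ext_alg_def)
  qed
  then show ?thesis by (auto simp: ext_alg_def)
qed

section \<open>The Orlik-Solomon ideal in its lowest degree\<close>

text \<open>The homogeneous component of degree \<open>p\<close>. Infinite sets have
  \<open>card\<close> 0, so for \<open>p > 0\<close> only finite sets contribute.\<close>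

definition ext_part :: "nat \<Rightarrow> ext \<Rightarrow> ext" where
  "ext_part p a = (\<lambda>S. if card S = p then a S else 0)"

lemma ext_part_of_deg:
  assumes "a \<in> ext_deg n q"
  shows "ext_part p a = (if p = q then a else 0)"
  using assms by (auto simp: ext_part_def ext_deg_def fun_eq_iff)

lemma shuffle_sign_empty_right: "shuffle_sign S {} = 1"
  by (simp add: shuffle_sign_def)

text \<open>Degrees add under the wedge product, so nothing appears below \<open>p\<close>, and in
  degree \<open>p\<close> only the scalar part \<open>a {}\<close> of the other factor can
  contribute.\<close>

lemma wedge_lowest_degree:
  assumes low: "\<And>S. card S < p \<Longrightarrow> b S = 0"
  shows "card U < p \<Longrightarrow> wedge a b U = 0" and "card U < p \<Longrightarrow> wedge b a U = 0"
    and "p > 0 \<Longrightarrow> ext_part p (wedge a b) = cscale (a {}) (ext_part p b)"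
    and "p > 0 \<Longrightarrow> ext_part p (wedge b a) = cscale (a {}) (ext_part p b)"
proof -
  show "wedge a b U = 0" if "card U < p"
  proof (cases "finite U")
    case True
    then have "b (U - S) = 0" for S
      using that by (intro low) (meson Diff_subset card_mono le_less_trans)
    then show ?thesis by (simp add: wedge_def)
  qed (simp add: wedge_infinite)
  show "wedge b a U = 0" if "card U < p"
  proof (cases "finite U")
    case True
    then have "b S = 0" if "S \<in> Pow U" for S
      using that \<open>card U < p\<close> by (intro low) (meson PowD card_mono le_less_trans)
    then show ?thesis by (simp add: wedge_def)
  qed (simp add: wedge_infinite)
  show "ext_part p (wedge a b) = cscale (a {}) (ext_part p b)" if "p > 0"
  proof -
    have "wedge a b U = a {} * b U" if U: "card U = p" for U
    proof -
      have fin: "finite U" using U \<open>p > 0\<close> card_gt_0_iff by blast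
      have "wedge a b U = (\<Sum>S\<in>Pow U. if S = {} then a {} * b U else 0)"
        unfolding wedge_def
      proof (intro sum.cong refl)
        fix S assume "S \<in> Pow U"
        then have "S \<noteq> {} \<Longrightarrow> card (U - S) < p"
          using fin U by (intro psubset_card_mono[of U "U - S", unfolded U]) auto
        then show "shuffle_sign S (U - S) * a S * b (U - S) = (if S = {} then a {} * b U else 0)"
          using low by (auto simp: shuffle_sign_def)
      qed
      then show ?thesis using fin by simp
    qed
    then show ?thesis by (auto simp: ext_part_def cscale_def)
  qed
  show "ext_part p (wedge b a) = cscale (a {}) (ext_part p b)" if "p > 0"
  proof -
    have "wedge b a U = a {} * b U" if U: "card U = p" for U
    proof -
      have fin: "finite U" using U \<open>p > 0\<close> card_gt_0_iff by blast
      have "wedge b a U = (\<Sum>S\<in>Pow U. if S = U then a {} * b U else 0)"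
        unfolding wedge_def
      proof (intro sum.cong refl)
        fix S assume "S \<in> Pow U"
        then have "S \<noteq> U \<Longrightarrow> card S < p"
          using fin U by (intro psubset_card_mono[of U S, unfolded U]) auto
        then show "shuffle_sign S (U - S) * b S * a (U - S) = (if S = U then a {} * b U else 0)"
          using low shuffle_sign_empty_right[of U] by auto
      qed
      then show ?thesis using fin by simp
    qed
    then show ?thesis by (auto simp: ext_part_def cscale_def)
  qed
qed

lemma subspace_ext_deg: "cfun.subspace (ext_deg n p)"
proof (rule cfun.subspaceI)
  show "x + y \<in> ext_deg n p" if "x \<in> ext_deg n p" "y \<in> ext_deg n p" for x y
    using that by (simp add: ext_deg_def ext_alg_def) (metis add.right_neutral)
qed (auto simp: ext_deg_def ext_alg_def cscale_def)

text \<open>No generator has degree below \<open>p\<close>, and multiplying by elements of positive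
  degree only moves upwards. Hence degree \<open>p\<close> of the ideal is spanned by the generators
  of that degree.\<close>

lemma os_ideal_deg_lowest:
  assumes "p > 0"
    and low: "\<And>S. S \<subseteq> {..n} \<Longrightarrow> cfun.dependent (\<alpha> ` S) \<Longrightarrow> card S > p"
  shows "os_ideal_deg n \<alpha> p =
    cfun.span ((\<lambda>S. ext_diff n (ext_basis S)) ` {S. S \<subseteq> {..n} \<and> card S = Suc p \<and> cfun.dependent (\<alpha> ` S)})"
    (is "_ = cfun.span ?G")
proof
  let ?D = "{ext_diff n (ext_basis S) |S. S \<subseteq> {..n} \<and> cfun.dependent (\<alpha> ` S)}"
  \<comment> \<open>An ideal that contains all generators and whose part of degree \<open>p\<close>
    is the span by construction; minimality of the hull then bounds the Orlik-Solomon ideal from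
    above.\<close>
  define J where
    "J = {a \<in> ext_alg n. (\<forall>S. card S < p \<longrightarrow> a S = 0) \<and> ext_part p a \<in> cfun.span ?G}"
  have "cfun.subspace J"
  proof (rule cfun.subspaceI)
    have "ext_part p 0 = 0" by (auto simp: ext_part_def)
    then show "0 \<in> J" by (auto simp: J_def ext_alg_def cfun.span_zero)
  next
    fix x y assume "x \<in> J" "y \<in> J"
    moreover have "ext_part p (x + y) = ext_part p x + ext_part p y"
      by (auto simp: ext_part_def)
    moreover have "x + y \<in> ext_alg n" if "x \<in> ext_alg n" "y \<in> ext_alg n"
      using that by (simp add: ext_alg_def) (metis add.right_neutral)
    ultimately show "x + y \<in> J" by (auto simp: J_def cfun.span_add simp del: plus_fun_apply)
        (simp add: plus_fun_apply)
  next
    fix c x assume "x \<in> J"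
    moreover have "ext_part p (cscale c x) = cscale c (ext_part p x)"
      by (auto simp: ext_part_def cscale_def)
    ultimately show "cscale c x \<in> J"
      by (auto simp: J_def cfun.span_scale) (auto simp: ext_alg_def cscale_def)
  qed
  then have "ext_ideal n J"
    unfolding ext_ideal_def using \<open>p > 0\<close>
    by (auto simp: J_def wedge_in_ext_alg wedge_lowest_degree[of p] cfun.span_scale)
  moreover have "?D \<subseteq> J"
  proof clarify
    fix S assume S: "S \<subseteq> {..n}" "cfun.dependent (\<alpha> ` S)"
    then have "p < card S" using low by blast
    then obtain q where q: "card S = Suc q" "p \<le> q" by (cases "card S") auto
    have deg: "ext_diff n (ext_basis S) \<in> ext_deg n q"
      using S q ext_diff_basis_in_ext_deg by blast
    \<comment> \<open>A generator of degree \<open>q = p\<close> is one of the spanning vectors; for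
      \<open>q > p\<close> its component in degree \<open>p\<close> is 0.\<close>
    then have "ext_part p (ext_diff n (ext_basis S)) \<in> cfun.span ?G"
      using S q by (auto simp: ext_part_of_deg[OF deg] cfun.span_zero intro!: cfun.span_base)
    then show "ext_diff n (ext_basis S) \<in> J"
      using deg q by (force simp: J_def ext_deg_def)
  qed
  ultimately have "os_ideal n \<alpha> \<subseteq> J"
    unfolding os_ideal_def by (rule hull_minimal[rotated])
  then show "os_ideal_deg n \<alpha> p \<subseteq> cfun.span ?G"
    by (auto simp: os_ideal_deg_def J_def ext_part_of_deg)
  have "cfun.subspace (os_ideal n \<alpha>)"
    unfolding os_ideal_def hull_def by (auto simp: ext_ideal_def intro!: cfun.subspace_Inter)
  then have "cfun.subspace (os_ideal_deg n \<alpha> p)"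
    unfolding os_ideal_deg_def by (intro cfun.subspace_inter subspace_ext_deg)
  moreover have "?G \<subseteq> os_ideal_deg n \<alpha> p"
    unfolding os_ideal_deg_def os_ideal_def
    by (auto intro!: hull_inc ext_diff_basis_in_ext_deg)
  ultimately show "cfun.span ?G \<subseteq> os_ideal_deg n \<alpha> p"
    by (intro cfun.span_minimal)
qed

section \<open>The multiplication kernel when the dependent triples share one index\<close>

text \<open>For each \<open>p\<close> the three products \<open>e i \<and> g p\<close> with
  \<open>i \<in> insert z p\<close> coincide, which gives two independent relations. Disjointness
  rules out relations between different pairs and turns the sum of the \<open>card p\<close> into
  the size of the union.\<close>

lemma falk_invariant_disjoint_pairs:
  assumes "z \<le> n"
    and P: "\<And>p. p \<in> P \<Longrightarrow> p \<subseteq> {..n} - {z} \<and> card p = 2"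
    and disj: "pairwise disjnt P"
    and dep: "\<And>S. S \<subseteq> {..n} \<Longrightarrow> card S \<le> 3 \<Longrightarrow> cfun.dependent (\<alpha> ` S) \<longleftrightarrow> S \<in> insert z ` P"
  shows "falk_invariant n \<alpha> = card (\<Union>P)"
proof -
  define g where "g p = ext_diff n (ext_basis (insert z p))" for p
  define e :: "nat \<Rightarrow> ext" where "e i = ext_basis {i}" for i
  define f where "f = (\<lambda>(p, i). pure_tensor (e i - e z) (g p))"
  define X where "X = (SIGMA p:P. p)"
  define K where "K = {t \<in> tensor_product (ext_deg n 1) (os_ideal_deg n \<alpha> 2). wedge_map t = 0}"
  have "P \<subseteq> Pow {..n}" using P by blast
  then have finP: "finite P" by (rule finite_subset) simp
  have finp: "finite p" if "p \<in> P" for p using P[OF that] card_ge_0_finite[of p] by simp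
  have zp: "z \<notin> p" if "p \<in> P" for p using P[OF that] by blast
  have finX: "finite X" unfolding X_def using finP finp by auto
  have g_val: "g p T = (if T = p then (- 1) ^ card {j \<in> p. j < z} else 0)" if "p \<in> P" "z \<notin> T" for p T
    unfolding g_def using ext_diff_basis_insert \<open>z \<le> n\<close> zp that by simp
  have wedge_in: "wedge (e i) (g p) = ext_basis (insert z p)" if "p \<in> P" "i \<in> insert z p" for p i
    unfolding e_def g_def using that P[OF that(1)] \<open>z \<le> n\<close>
    by (intro wedge_generator_ext_diff_basis) auto
  have card3: "card (insert z p) = 3" if "p \<in> P" for p
    using P[OF that] finp[OF that] zp[OF that] by simp
  have I2: "os_ideal_deg n \<alpha> 2 = cfun.span (g ` P)"
  proof -
    have "{S. S \<subseteq> {..n} \<and> card S = Suc 2 \<and> cfun.dependent (\<alpha> ` S)} = insert z ` P"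
    proof (intro equalityI subsetI)
      fix S assume "S \<in> insert z ` P"
      then obtain p where p: "p \<in> P" "S = insert z p" by blast
      then have "S \<subseteq> {..n}" using P[OF p(1)] \<open>z \<le> n\<close> by auto
      then show "S \<in> {S. S \<subseteq> {..n} \<and> card S = Suc 2 \<and> cfun.dependent (\<alpha> ` S)}"
        using dep[of S] card3[OF p(1)] p by auto
    qed (use dep in auto)
    \<comment> \<open>A dependent set with at most three elements is one of the triples, so 2 is the
      lowest degree to consider.\<close>
    moreover have "2 < card S" if "S \<subseteq> {..n}" "cfun.dependent (\<alpha> ` S)" for S
      using dep[OF that(1)] that(2) card3 by (cases "card S \<le> 3") auto
    ultimately show ?thesis
      using os_ideal_deg_lowest[of 2 n \<alpha>] by (simp add: g_def image_image)
  qed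
  \<comment> \<open>Points dual to the tensors \<open>f (p, i)\<close>: as
    \<open>z \<notin> p\<close>, the set \<open>{i}\<close> detects \<open>e i\<close> but not
    \<open>e z\<close>, and the set \<open>p\<close> detects \<open>g p\<close> alone.\<close>
  define y where "y = (\<lambda>(p, i :: nat). ({i}, p :: nat set))"
  have "f (p, i) (y (p, i)) \<noteq> 0" if "(p, i) \<in> X" for p i
    using that zp by (auto simp: X_def f_def y_def pure_tensor_def e_def ext_basis_def g_val)
  moreover have "f (q, j) (y (p, i)) = 0" if "(p, i) \<in> X" "(q, j) \<in> X" "(q, j) \<noteq> (p, i)" for p i q j
    using that zp by (auto simp: X_def f_def y_def pure_tensor_def e_def ext_basis_def g_val)
  ultimately have inj: "inj_on f X" and indep: "cfun.independent (f ` X)"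
    using independent_image_dual_points[OF finX, of f y] by auto
  have "falk_invariant n \<alpha> = cfun.dim K" by (simp add: falk_invariant_def K_def)
  also have "\<dots> = card (f ` X)"
  proof (rule cfun.dim_unique[OF _ _ _ refl])
    show "f ` X \<subseteq> K"
    proof clarify
      fix p i assume "(p, i) \<in> X"
      then have pi: "p \<in> P" "i \<in> p" by (auto simp: X_def)
      have "e i - e z \<in> ext_deg n 1"
        using pi P[OF pi(1)] \<open>z \<le> n\<close>
        by (intro cfun.subspace_diff subspace_ext_deg) (auto simp: e_def ext_basis_def ext_deg_def ext_alg_def)
      then have "f (p, i) \<in> tensor_product (ext_deg n 1) (os_ideal_deg n \<alpha> 2)"
        unfolding f_def tensor_product_def I2 using pi by (auto intro!: cfun.span_base)
      moreover have "wedge_map (f (p, i)) = wedge (e i) (g p) - wedge (e z) (g p)"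
        by (simp add: f_def wedge_map_pure_tensor) (auto simp: wedge_def algebra_simps sum_subtractf)
      then have "wedge_map (f (p, i)) = 0" using pi by (simp add: wedge_in)
      ultimately show "f (p, i) \<in> K" by (simp add: K_def)
    qed
    show "K \<subseteq> cfun.span (f ` X)"
    proof
      fix t assume t: "t \<in> K"
      define Y where "Y = {..n} \<times> P"
      define h where "h = (\<lambda>(i, p). pure_tensor (e i) (g p))"
      have finY: "finite Y" using finP by (simp add: Y_def)
      have sum_Y: "(\<Sum>(i, p)\<in>Y. F i p) = (\<Sum>p\<in>P. \<Sum>i\<le>n. F i p)" for F :: "nat \<Rightarrow> nat set \<Rightarrow> complex"
        by (subst sum.swap) (simp add: Y_def sum.cartesian_product)
      have "t \<in> cfun.span (h ` Y)"
      proof -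
        have "pure_tensor v w \<in> cfun.span (h ` Y)"
          if "v \<in> ext_deg n 1" "w \<in> os_ideal_deg n \<alpha> 2" for v w
        proof -
          have "{pure_tensor a b |a b. a \<in> e ` {..n} \<and> b \<in> g ` P} = h ` Y"
            by (auto simp: h_def Y_def)
          then show ?thesis
            using pure_tensor_in_span[of v "e ` {..n}" w "g ` P"] that ext_deg_one_span[of n]
            by (auto simp: I2 e_def)
        qed
        then have "tensor_product (ext_deg n 1) (os_ideal_deg n \<alpha> 2) \<subseteq> cfun.span (h ` Y)"
          unfolding tensor_product_def by (intro cfun.span_minimal) auto
        then show ?thesis using t by (auto simp: K_def)
      qed
      then obtain c' where "t = (\<Sum>y\<in>Y. cscale (c' y) (h y))"
        using span_image_combination[OF finY] by blast
      moreover define c where "c i p = c' (i, p)" for i p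
      ultimately have tc: "t = (\<Sum>(i, p)\<in>Y. cscale (c i p) (pure_tensor (e i) (g p)))"
        by (simp add: h_def case_prod_beta)
      \<comment> \<open>The kernel condition, read off at each coefficient \<open>U\<close>. Taking
        \<open>U = insert i p\<close> will give the vanishing of \<open>c i p\<close> for
        \<open>i\<close> outside \<open>insert z p\<close>, and \<open>U = insert z p\<close> one
        linear condition for each pair.\<close>
      have W: "(\<Sum>(i, p)\<in>Y. c i p * wedge (e i) (g p) U) = 0" for U
      proof -
        have "wedge_map t = 0" using t by (simp add: K_def)
        then have "(\<Sum>y\<in>Y. cscale (c (fst y) (snd y)) (wedge (e (fst y)) (g (snd y)))) U = 0"
          unfolding tc case_prod_beta wedge_map_combination wedge_map_pure_tensor by simp
        then show ?thesis by (simp add: sum_cscale_apply case_prod_beta)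
      qed
      \<comment> \<open>A pair in \<open>P\<close> contained in \<open>U = insert i p\<close> meets \<open>p\<close>, hence equals \<open>p\<close>; as \<open>z \<notin> U\<close>, only
        \<open>e\<^sub>i \<and> g\<^sub>p\<close> contributes to the coefficient at \<open>U\<close>.\<close>
      have out: "c i p = 0" if i: "i \<le> n" "i \<notin> insert z p" and p: "p \<in> P" for i p
      proof -
        define U where "U = insert i p"
        have finU: "finite U" and zU: "z \<notin> U" using finp[OF p] zp[OF p] i by (auto simp: U_def)
        have *: "wedge (e j) (g q) U = 0" if jq: "q \<in> P" "(j, q) \<noteq> (i, p)" for j q
        proof (rule ccontr)
          assume "\<not> ?thesis"
          then have jU: "j \<in> U" and "g q (U - {j}) \<noteq> 0"
            by (auto simp: e_def wedge_generator[OF finU] split: if_splits)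
          then have q: "q = U - {j}" using g_val[OF jq(1)] zU by (metis Diff_iff)
          have "\<exists>x. x \<in> p \<and> x \<noteq> j"
            using P[OF p] by (metis card_2_iff' )
          then have "\<not> disjnt p q" using q by (auto simp: disjnt_def U_def)
          then have "q = p" using disj p jq(1) by (metis pairwiseD)
          then show False using q jq(2) jU i by (auto simp: U_def)
        qed
        have "U - {i} = p" using i by (auto simp: U_def)
        then have "wedge (e i) (g p) U \<noteq> 0"
          using zp[OF p] p by (simp add: e_def wedge_generator[OF finU] g_val) (simp add: U_def)
        moreover have "(\<Sum>(j, q)\<in>Y. c j q * wedge (e j) (g q) U) =
            (\<Sum>y\<in>Y. if y = (i, p) then c i p * wedge (e i) (g p) U else 0)"
        proof (intro sum.cong refl)
          fix y assume "y \<in> Y"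
          then show "(case y of (j, q) \<Rightarrow> c j q * wedge (e j) (g q) U) =
              (if y = (i, p) then c i p * wedge (e i) (g p) U else 0)"
            using *[of "snd y" "fst y"] by (cases y) (auto simp: Y_def)
        qed
        then have "c i p * wedge (e i) (g p) U = 0"
          using W[of U] finY i p by (simp add: Y_def)
        ultimately show ?thesis by simp
      qed
      have sum_in: "(\<Sum>i\<le>n. c i p * x i) = (\<Sum>i\<in>insert z p. c i p * x i)" if "p \<in> P" for p x
        using out that P[OF that] \<open>z \<le> n\<close> by (intro sum.mono_neutral_right) auto
      \<comment> \<open>After \<open>out\<close>, the remaining products for \<open>q\<close> all
        equal the basis wedge of \<open>insert z q\<close>, and this is the wedge of
        \<open>insert z p\<close> only for \<open>q = p\<close>.\<close>
      have zero: "(\<Sum>i\<in>insert z p. c i p) = 0" if p: "p \<in> P" for p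
      proof -
        have "0 = (\<Sum>q\<in>P. \<Sum>i\<le>n. c i q * wedge (e i) (g q) (insert z p))"
          using W[of "insert z p"] by (simp add: sum_Y)
        also have "\<dots> = (\<Sum>q\<in>P. if q = p then \<Sum>i\<in>insert z p. c i p else 0)"
        proof (intro sum.cong refl)
          fix q assume q: "q \<in> P"
          have "(\<Sum>i\<le>n. c i q * wedge (e i) (g q) (insert z p)) =
              (\<Sum>i\<in>insert z q. c i q * ext_basis (insert z q) (insert z p))"
            unfolding sum_in[OF q] using wedge_in[OF q] by (intro sum.cong) auto
          moreover have "insert z p = insert z q \<longleftrightarrow> q = p"
            using zp[OF p] zp[OF q] by (metis insert_ident)
          ultimately show "(\<Sum>i\<le>n. c i q * wedge (e i) (g q) (insert z p)) =
              (if q = p then \<Sum>i\<in>insert z p. c i p else 0)"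
            by (auto simp: ext_basis_def)
        qed
        also have "\<dots> = (\<Sum>i\<in>insert z p. c i p)" using finP p by simp
        finally show ?thesis by simp
      qed
      have "t = (\<Sum>p\<in>P. \<Sum>i\<in>p. cscale (c i p) (f (p, i)))"
      proof
        fix y :: "nat set \<times> nat set"
        obtain S T where y: "y = (S, T)" by fastforce
        have "t y = (\<Sum>p\<in>P. \<Sum>i\<le>n. c i p * (e i S * g p T))"
          unfolding tc y case_prod_beta sum_cscale_apply sum_Y[symmetric] pure_tensor_def by simp
        also have "\<dots> = (\<Sum>p\<in>P. \<Sum>i\<in>p. c i p * f (p, i) (S, T))"
        proof (rule sum.cong[OF refl])
          fix p assume p: "p \<in> P"
          \<comment> \<open>Eliminating the coefficient of \<open>e z\<close> leaves only the
            differences \<open>e i - e z\<close>.\<close>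
          have cz: "c z p = - (\<Sum>i\<in>p. c i p)"
            using zero[OF p] zp[OF p] finp[OF p] by (simp add: add_eq_0_iff2)
          have "(\<Sum>i\<le>n. c i p * (e i S * g p T)) = (\<Sum>i\<in>insert z p. c i p * (e i S * g p T))"
            by (rule sum_in[OF p])
          also have "\<dots> = c z p * (e z S * g p T) + (\<Sum>i\<in>p. c i p * (e i S * g p T))"
            using zp[OF p] finp[OF p] by simp
          also have "\<dots> = (\<Sum>i\<in>p. c i p * ((e i S - e z S) * g p T))"
            unfolding cz by (simp add: algebra_simps sum_subtractf sum_distrib_left sum_distrib_right)
          finally show "(\<Sum>i\<le>n. c i p * (e i S * g p T)) = (\<Sum>i\<in>p. c i p * f (p, i) (S, T))"
            by (simp add: f_def pure_tensor_def)
        qed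
        finally show "t y = (\<Sum>p\<in>P. \<Sum>i\<in>p. cscale (c i p) (f (p, i))) y"
          by (simp add: sum_fun_apply cscale_def y)
      qed
      also have "\<dots> \<in> cfun.span (f ` X)"
        by (intro cfun.span_sum cfun.span_scale cfun.span_base) (auto simp: X_def)
      finally show "t \<in> cfun.span (f ` X)" .
    qed
  next
    show "cfun.independent (f ` X)" by (rule indep)
  qed
  also have "\<dots> = card X" by (rule card_image[OF inj])
  also have "\<dots> = (\<Sum>p\<in>P. card p)"
    unfolding X_def using finP finp by (simp add: card_SigmaI)
  also have "\<dots> = card (\<Union>P)"
    using disj finp by (simp add: card_Union_disjoint)
  finally show ?thesis .
qed

section \<open>Linear forms and labels for the semiorder cone\<close>

text \<open>Vectors supported on two coordinates suffice: fix \<open>m\<close> with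
  \<open>b m \<noteq> 0\<close> and compare every other coordinate with \<open>m\<close>.\<close>

lemma hyperplane_eq_imp_proportional:
  assumes a: "a \<in> coord_space d" "a \<noteq> 0" and b: "b \<in> coord_space d" "b \<noteq> 0"
    and eq: "hyperplane d a = hyperplane d b"
  shows "\<exists>c. c \<noteq> 0 \<and> a = cscale c b"
proof -
  obtain m where m: "b m \<noteq> 0" using b(2) by (auto simp: fun_eq_iff)
  then have md: "m < d" using b(1) by (force simp: coord_space_def not_le[symmetric])
  have cross: "b m * a k = b k * a m" if "k < d" "k \<noteq> m" for k
  proof -
    \<comment> \<open>Chosen to be annihilated by \<open>b\<close>; since \<open>a\<close>
      annihilates it too, the minor of \<open>a\<close> and \<open>b\<close> at the columns
      \<open>k\<close> and \<open>m\<close> vanishes.\<close>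
    define x where "x = (\<lambda>i. if i = k then b m else if i = m then - b k else 0)"
    have dot: "(\<Sum>i<d. w i * x i) = w k * b m - w m * b k" for w
    proof -
      have "(\<Sum>i<d. w i * x i) = (\<Sum>i\<in>{k, m}. w i * x i)"
        using that md by (intro sum.mono_neutral_right) (auto simp: x_def)
      then show ?thesis using that by (simp add: x_def)
    qed
    have "x \<in> coord_space d" using that md by (auto simp: coord_space_def x_def)
    then have "x \<in> hyperplane d b" by (simp add: hyperplane_def dot)
    then have "x \<in> hyperplane d a" by (simp add: eq)
    then show ?thesis by (simp add: hyperplane_def dot algebra_simps)
  qed
  have "a k = (a m / b m) * b k" for k
  proof (cases "k < d \<and> k \<noteq> m")
    case True
    then show ?thesis using cross[of k] m by (simp add: field_simps)
  next
    case False
    then show ?thesis using m a(1) b(1) by (auto simp: coord_space_def)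
  qed
  then have "a = cscale (a m / b m) b" unfolding cscale_def by (rule ext)
  moreover from this have "a m / b m \<noteq> 0" using a(2) by auto
  ultimately show ?thesis by blast
qed

text \<open>The label \<open>(i, j)\<close> stands for the form \<open>x\<^sub>i - x\<^sub>j - x\<^sub>0\<close>. The hyperplane \<open>x\<^sub>i - x\<^sub>j + x\<^sub>0 = 0\<close> then
  has the label \<open>(j, i)\<close>, and the hyperplane \<open>x\<^sub>0 = 0\<close> has the label \<open>(0, 0)\<close>.\<close>

definition semiorder_form :: "nat \<times> nat \<Rightarrow> nat \<Rightarrow> complex" where
  "semiorder_form = (\<lambda>(i, j) k. of_bool (k = i) - of_bool (k = j) - of_bool (k = 0))"

definition semiorder_labels :: "nat \<Rightarrow> (nat \<times> nat) set" where
  "semiorder_labels l = insert (0, 0) {(i, j). i \<in> {1..l} \<and> j \<in> {1..l} \<and> i \<noteq> j}"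

lemma hyperplane_semiorder_form:
  assumes "i \<le> l" and "j \<le> l"
  shows "hyperplane (l + 1) (semiorder_form (i, j)) = {x \<in> coord_space (l + 1). x i - x j - x 0 = 0}"
proof -
  have "(\<Sum>k<l + 1. semiorder_form (i, j) k * x k) = x i - x j - x 0" for x
  proof -
    have "(\<Sum>k<l + 1. semiorder_form (i, j) k * x k) = (\<Sum>k<l + 1. if k = i then x i else 0)
        - (\<Sum>k<l + 1. if k = j then x j else 0) - (\<Sum>k<l + 1. if k = 0 then x 0 else 0)"
      unfolding sum_subtractf[symmetric]
      by (rule sum.cong) (auto simp: semiorder_form_def algebra_simps)
    then show ?thesis using assms by (simp add: less_Suc_eq_le del: sum.lessThan_Suc)
  qed
  then show ?thesis by (simp add: hyperplane_def)
qed

lemma semiorder_cone_eq: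
  "semiorder_cone l = (\<lambda>e. hyperplane (l + 1) (semiorder_form e)) ` semiorder_labels l"
proof -
  define h where "h i j = {x \<in> coord_space (l + 1). x i - x j - x 0 = 0}" for i j
  have flip: "{x \<in> coord_space (l + 1). x i - x j + x 0 = 0} = h j i" for i j
    unfolding h_def by (intro Collect_cong conj_cong refl) (auto simp: algebra_simps add_eq_0_iff)
  have zero: "{x \<in> coord_space (l + 1). x 0 = 0} = h 0 0"
    by (auto simp: h_def)
  have "semiorder_cone l = {h 0 0} \<union> {h j i |i j. 1 \<le> i \<and> i < j \<and> j \<le> l} \<union>
      {h i j |i j. 1 \<le> i \<and> i < j \<and> j \<le> l}"
    unfolding semiorder_cone_def flip zero by (simp add: h_def)
  also have "\<dots> = (\<lambda>(i, j). h i j) ` semiorder_labels l"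
  proof (intro equalityI subsetI)
    fix H assume "H \<in> (\<lambda>(i, j). h i j) ` semiorder_labels l"
    then consider "H = h 0 0"
      | i j where "H = h i j" "i \<in> {1..l}" "j \<in> {1..l}" "i < j"
      | i j where "H = h i j" "i \<in> {1..l}" "j \<in> {1..l}" "j < i"
      by (auto simp: semiorder_labels_def) (metis linorder_neqE_nat)
    then show "H \<in> {h 0 0} \<union> {h j i |i j. 1 \<le> i \<and> i < j \<and> j \<le> l} \<union>
        {h i j |i j. 1 \<le> i \<and> i < j \<and> j \<le> l}"
      by cases auto
  qed (fastforce simp: semiorder_labels_def)
  also have "\<dots> = (\<lambda>e. hyperplane (l + 1) (semiorder_form e)) ` semiorder_labels l"
  proof (rule image_cong[OF refl])
    fix e assume "e \<in> semiorder_labels l"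
    then obtain i j where "e = (i, j)" "i \<le> l" "j \<le> l" by (auto simp: semiorder_labels_def)
    then show "(case e of (i, j) \<Rightarrow> h i j) = hyperplane (l + 1) (semiorder_form e)"
      using hyperplane_semiorder_form[of i l j] by (simp add: h_def)
  qed
  finally show ?thesis .
qed

lemma semiorder_form_in_coord_space: "e \<in> semiorder_labels l \<Longrightarrow> semiorder_form e \<in> coord_space (l + 1)"
  by (auto simp: semiorder_labels_def semiorder_form_def coord_space_def)

text \<open>This normalization has two uses: proportional labelled forms are equal, and the
  coefficients of any linear relation between them sum to 0.\<close>

lemma semiorder_form_at_0: "e \<in> semiorder_labels l \<Longrightarrow> semiorder_form e 0 = - 1"
  by (auto simp: semiorder_labels_def semiorder_form_def)

lemma semiorder_form_nonzero: "e \<in> semiorder_labels l \<Longrightarrow> semiorder_form e \<noteq> 0"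
  using semiorder_form_at_0[of e l] by auto

text \<open>Coordinate 0 forces the factor 1; away from 0, the places of the entries 1 and -1
  recover the label, and \<open>(0, 0)\<close> is the label with no such entries.\<close>

lemma semiorder_form_proportional_imp_eq:
  assumes "e \<in> semiorder_labels l" "e' \<in> semiorder_labels l"
    and eq: "semiorder_form e = cscale c (semiorder_form e')"
  shows "e = e'"
proof -
  have "c = 1"
    using semiorder_form_at_0 assms(1,2) fun_cong[OF eq, of 0] by (simp add: cscale_def)
  then have *: "semiorder_form e k = semiorder_form e' k" for k
    using eq by (simp add: cscale_def)
  obtain i j i' j' where e: "e = (i, j)" "e' = (i', j')" by fastforce
  show ?thesis
    using assms(1,2) *[of i] *[of j] *[of i'] *[of j'] unfolding e semiorder_labels_def semiorder_form_def
    by (auto split: if_splits simp: of_bool_def)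
qed

lemma card_semiorder_labels: "card (semiorder_labels l) = Suc (l * (l - 1))"
proof -
  let ?E = "{(i, j). i \<in> {1..l} \<and> j \<in> {1..l} \<and> i \<noteq> j}"
  have "?E = {1..l} \<times> {1..l} - (\<lambda>i. (i, i)) ` {1..l}" by auto
  moreover have "card ((\<lambda>i. (i, i)) ` {1..l}) = l" by (subst card_image) (auto simp: inj_on_def)
  ultimately have "card ?E = l * (l - 1)"
    by (subst \<open>?E = _\<close>, subst card_Diff_subset) (auto simp: diff_mult_distrib2)
  moreover have "finite ?E" by (rule finite_subset[of _ "{1..l} \<times> {1..l}"]) auto
  ultimately show ?thesis by (simp add: semiorder_labels_def)
qed

section \<open>Supports of short linear relations between the labelled forms\<close>

text \<open>Read the labels other than \<open>(0, 0)\<close> as directed edges on the vertices 1 to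
  \<open>l\<close>, with \<open>T\<close> the support of a relation. No vertex lies on just one
  edge, so at most three edges contain a 2-cycle or form a triangle. Coordinate 0 excludes a
  triangle and a 2-cycle on its own, so a 2-cycle together with \<open>(0, 0)\<close>
  remains.\<close>

lemma semiorder_form_relation:
  assumes T: "T \<subseteq> semiorder_labels l" "T \<noteq> {}" "finite T" "card T \<le> 3"
    and nz: "\<And>e. e \<in> T \<Longrightarrow> v e \<noteq> 0"
    and rel: "\<And>k. (\<Sum>e\<in>T. v e * semiorder_form e k) = 0"
  shows "\<exists>i j. (i, j) \<in> semiorder_labels l \<and> i \<noteq> j \<and> T = {(0, 0), (i, j), (j, i)}"
proof -
  have sum0: "(\<Sum>e\<in>T. v e) = 0"
  proof -
    have "(\<Sum>e\<in>T. v e * semiorder_form e 0) = (\<Sum>e\<in>T. - v e)"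
      using T(1) by (intro sum.cong refl) (auto simp: semiorder_form_at_0)
    then show ?thesis using rel[of 0] by (simp add: sum_negf)
  qed
  have edge: "i \<noteq> 0 \<and> j \<noteq> 0 \<and> i \<noteq> j" if "(i, j) \<in> T" "(i, j) \<noteq> (0, 0)" for i j
    using that T(1) by (auto simp: semiorder_labels_def)
  \<comment> \<open>An edge that is alone at its endpoint \<open>x\<close> would be the only nonzero
    term of the relation in coordinate \<open>x\<close>.\<close>
  have touch: "\<exists>e\<in>T. e \<noteq> (i, j) \<and> x \<in> {fst e, snd e}"
    if ij: "(i, j) \<in> T" "(i, j) \<noteq> (0, 0)" "x \<in> {i, j}" for i j x
  proof (rule ccontr)
    assume *: "\<not> ?thesis"
    have "(\<Sum>e\<in>T. v e * semiorder_form e x) = (\<Sum>e\<in>{(i, j)}. v e * semiorder_form e x)"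
    proof (rule sum.mono_neutral_right)
      show "\<forall>e\<in>T - {(i, j)}. v e * semiorder_form e x = 0"
        using * edge[OF ij(1,2)] ij(3) by (auto simp: semiorder_form_def)
    qed (use T ij in auto)
    moreover have "semiorder_form (i, j) x \<noteq> 0"
      using edge[OF ij(1,2)] ij(3) by (auto simp: semiorder_form_def)
    ultimately show False using rel[of x] nz[OF ij(1)] by simp
  qed
  have "\<exists>e\<in>T. e \<noteq> (0, 0)"
  proof (rule ccontr)
    assume "\<not> ?thesis"
    then have "T = {(0, 0)}" using T(2) by auto
    then show False using sum0 nz by simp
  qed
  then obtain i j where ij: "(i, j) \<in> T" "(i, j) \<noteq> (0, 0)" by (metis surj_pair)
  note eij = edge[OF ij]
  have ji: "(j, i) \<in> T"
  proof (rule ccontr)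
    assume nji: "(j, i) \<notin> T"
    obtain m where m: "m \<in> T" "m \<noteq> (i, j)" "i \<in> {fst m, snd m}" using touch[OF ij, of i] by auto
    obtain q where q: "q \<in> T" "q \<noteq> (i, j)" "j \<in> {fst q, snd q}" using touch[OF ij, of j] by auto
    obtain k where k: "m = (i, k) \<or> m = (k, i)" using m(3) by (cases m) auto
    obtain k' where k': "q = (j, k') \<or> q = (k', j)" using q(3) by (cases q) auto
    have kk: "k \<noteq> j" "k \<noteq> i" "k \<noteq> 0" "k' \<noteq> i" "k' \<noteq> j" "k' \<noteq> 0"
      using k k' m q nji eij edge by auto
    have "m \<noteq> q" using k k' kk eij by auto
    then have "card {(i, j), m, q} = 3" using m q by auto
    then have Teq: "T = {(i, j), m, q}"
      using card_seteq[of T "{(i, j), m, q}"] T ij m q by simp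
    \<comment> \<open>The far end \<open>k\<close> of \<open>m\<close> must lie on a second edge;
      the only candidate is \<open>q\<close>, which closes the triangle.\<close>
    have "k' = k"
    proof -
      obtain a b where ab: "m = (a, b)" by fastforce
      then have "(a, b) \<in> T" "(a, b) \<noteq> (0, 0)" "k \<in> {a, b}" using m k kk by auto
      then obtain e where "e \<in> T" "e \<noteq> m" "k \<in> {fst e, snd e}" using touch ab by metis
      then show ?thesis using Teq kk k' by auto
    qed
    have sums: "(\<Sum>e\<in>T. F e) = F (i, j) + F m + F q" for F :: "nat \<times> nat \<Rightarrow> complex"
      unfolding Teq using m(2) q(2) \<open>m \<noteq> q\<close> by (simp add: add.assoc)
    \<comment> \<open>Coordinates \<open>i\<close> and \<open>j\<close> make \<open>v m\<close> and
      \<open>v q\<close> equal to \<open>v (i, j)\<close> up to sign. Their total is then an odd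
      multiple of \<open>v (i, j)\<close>, yet coordinate 0 makes it 0.\<close>
    have "v (i, j) + v m + v q = 0" using sum0 by (simp add: sums)
    moreover have "v (i, j) + (if m = (i, k) then v m else - v m) = 0"
      using rel[of i] k k' kk eij \<open>k' = k\<close> by (auto simp: sums semiorder_form_def)
    moreover have "- v (i, j) + (if q = (j, k) then v q else - v q) = 0"
      using rel[of j] k k' kk eij \<open>k' = k\<close>
      by (auto simp: sums semiorder_form_def minus_equation_iff[of "v (i, j)"])
    ultimately have "v (i, j) = 0"
      by (auto simp: add_eq_0_iff2 split: if_splits)
    then show False using nz ij by blast
  qed
  have "(0, 0) \<in> T"
  proof (rule ccontr)
    assume n0: "(0, 0) \<notin> T"
    have "T = {(i, j), (j, i)}"
    proof (rule ccontr)
      assume "T \<noteq> {(i, j), (j, i)}"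
      then have "\<exists>e\<in>T. e \<noteq> (i, j) \<and> e \<noteq> (j, i)" using ij ji by blast
      then obtain a b where ab: "(a, b) \<in> T" "(a, b) \<noteq> (i, j)" "(a, b) \<noteq> (j, i)" by force
      then have "card {(i, j), (j, i), (a, b)} = 3" using eij by auto
      then have Teq: "T = {(i, j), (j, i), (a, b)}"
        using card_seteq[of T "{(i, j), (j, i), (a, b)}"] T ij ji ab by simp
      have "(a, b) \<noteq> (0, 0)" using n0 ab(1) by metis
      then have "a \<noteq> b" using edge[OF ab(1)] by blast
      \<comment> \<open>A third edge different from both orientations has an endpoint off the
        2-cycle, where it would be alone.\<close>
      then have "a \<notin> {i, j} \<or> b \<notin> {i, j}" using ab(2,3) by auto
      then obtain x where "x \<in> {a, b}" "x \<notin> {i, j}" by blast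
      then show False using touch[OF ab(1) \<open>(a, b) \<noteq> (0, 0)\<close>, of x] Teq by auto
    qed
    then have "v (i, j) + v (j, i) = 0" "v (i, j) - v (j, i) = 0"
      using sum0 rel[of i] eij by (auto simp: semiorder_form_def)
    then have "v (i, j) = 0" by (simp add: add_eq_0_iff2)
    then show False using nz ij by blast
  qed
  moreover have "card {(0, 0), (i, j), (j, i)} = 3" using eij by auto
  ultimately have "T = {(0, 0), (i, j), (j, i)}"
    using card_seteq[of T "{(0, 0), (i, j), (j, i)}"] T ij ji by simp
  then show ?thesis using ij T(1) eij by blast
qed

section \<open>From the labelled forms to arbitrary defining forms\<close>

theorem theorem6p4:
  fixes l n :: nat and \<alpha> :: "nat \<Rightarrow> nat \<Rightarrow> complex"
  assumes "l \<ge> 1"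
    and "defining_forms (l + 1) n \<alpha> (semiorder_cone l)"
  shows "falk_invariant n \<alpha> = l * (l - 1)"
proof -
  let ?L = "semiorder_labels l" and ?H = "hyperplane (l + 1)"
  have \<alpha>: "\<alpha> m \<in> coord_space (l + 1)" "\<alpha> m \<noteq> 0" if "m \<le> n" for m
    using assms(2) that by (auto simp: defining_forms_def)
  have bij: "bij_betw (\<lambda>m. ?H (\<alpha> m)) {..n} ((\<lambda>e. ?H (semiorder_form e)) ` ?L)"
    using assms(2) by (simp add: defining_forms_def semiorder_cone_eq)
  \<comment> \<open>The hyperplanes determine the forms \<open>\<alpha> m\<close> only up to order
    and nonzero scalars; \<open>\<sigma>\<close> will record the label and \<open>c\<close> the
    scalar.\<close>
  have "\<forall>m\<in>{..n}. \<exists>e c. e \<in> ?L \<and> c \<noteq> 0 \<and> \<alpha> m = cscale c (semiorder_form e)"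
  proof
    fix m assume m: "m \<in> {..n}"
    then obtain e where e: "e \<in> ?L" "?H (\<alpha> m) = ?H (semiorder_form e)"
      using bij_betwE[OF bij] by blast
    then show "\<exists>e c. e \<in> ?L \<and> c \<noteq> 0 \<and> \<alpha> m = cscale c (semiorder_form e)"
      using hyperplane_eq_imp_proportional \<alpha> m semiorder_form_in_coord_space semiorder_form_nonzero
      by (metis atMost_iff)
  qed
  then obtain \<sigma> c where \<sigma>c: "\<And>m. m \<le> n \<Longrightarrow> \<sigma> m \<in> ?L \<and> c m \<noteq> 0 \<and> \<alpha> m = cscale (c m) (semiorder_form (\<sigma> m))"
    by (metis atMost_iff)
  have hyp: "?H (\<alpha> m) = ?H (semiorder_form (\<sigma> m))" if "m \<le> n" for m
  proof -
    have "(\<Sum>k<l + 1. \<alpha> m k * x k) = c m * (\<Sum>k<l + 1. semiorder_form (\<sigma> m) k * x k)" for x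
      using \<sigma>c[OF that] by (simp add: cscale_def sum_distrib_left mult.assoc del: sum.lessThan_Suc)
    then show ?thesis using \<sigma>c[OF that] by (simp add: hyperplane_def del: sum.lessThan_Suc)
  qed
  have inj\<alpha>: "inj_on \<alpha> {..n}"
    using bij by (auto simp: bij_betw_def inj_on_def)
  have bij\<sigma>: "bij_betw \<sigma> {..n} ?L"
  proof (intro bij_betw_imageI)
    show "inj_on \<sigma> {..n}"
      using bij hyp unfolding bij_betw_def inj_on_def by (metis atMost_iff)
    have "e \<in> \<sigma> ` {..n}" if e: "e \<in> ?L" for e
    proof -
      have "?H (semiorder_form e) \<in> (\<lambda>m. ?H (\<alpha> m)) ` {..n}"
        using bij e by (auto simp: bij_betw_def)
      then obtain m where m: "m \<le> n" "?H (semiorder_form e) = ?H (semiorder_form (\<sigma> m))"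
        using hyp by auto
      have "\<exists>c. c \<noteq> 0 \<and> semiorder_form e = cscale c (semiorder_form (\<sigma> m))"
        using e m \<sigma>c[OF m(1)]
        by (intro hyperplane_eq_imp_proportional[of _ "l + 1"] semiorder_form_in_coord_space)
          (auto dest: semiorder_form_nonzero)
      then have "e = \<sigma> m" using semiorder_form_proportional_imp_eq e \<sigma>c[OF m(1)] by blast
      then show ?thesis using m by auto
    qed
    then show "\<sigma> ` {..n} = ?L" using \<sigma>c by auto
  qed
  define \<tau> where "\<tau> = inv_into {..n} \<sigma>"
  have bij\<tau>: "bij_betw \<tau> ?L {..n}" unfolding \<tau>_def using bij\<sigma> by (rule bij_betw_inv_into)
  have \<sigma>\<tau>: "\<sigma> (\<tau> e) = e" if "e \<in> ?L" for e
    unfolding \<tau>_def using bij\<sigma> that by (simp add: bij_betw_def f_inv_into_f)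
  have \<tau>\<sigma>: "\<tau> (\<sigma> m) = m" if "m \<le> n" for m
    unfolding \<tau>_def using bij\<sigma> that by (simp add: bij_betw_def)
  have \<tau>n: "\<tau> e \<le> n" if "e \<in> ?L" for e using bij_betwE[OF bij\<tau>] that by auto
  have \<tau>_eq: "\<tau> e = \<tau> e' \<longleftrightarrow> e = e'" if "e \<in> ?L" "e' \<in> ?L" for e e'
    using \<sigma>\<tau> that by metis
  define E where "E = {(i, j). (i, j) \<in> ?L \<and> i \<noteq> j}"
  \<comment> \<open>Two opposite labels belong to the parallel hyperplanes
    \<open>x\<^sub>i - x\<^sub>j = 1\<close> and \<open>x\<^sub>i - x\<^sub>j = -1\<close> of the
    slice \<open>x\<^sub>0 = 1\<close>.\<close>
  define P where "P = {{\<tau> (i, j), \<tau> (j, i)} |i j. (i, j) \<in> E}"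
  define z where "z = \<tau> (0, 0)"
  have zL: "(0, 0) \<in> ?L" by (simp add: semiorder_labels_def)
  have E: "(i, j) \<in> ?L" "(j, i) \<in> ?L" "i \<noteq> j" if "(i, j) \<in> E" for i j
    using that by (auto simp: E_def semiorder_labels_def)
  have "falk_invariant n \<alpha> = card (\<Union>P)"
  proof (rule falk_invariant_disjoint_pairs)
    show "z \<le> n" unfolding z_def by (rule \<tau>n[OF zL])
    show "p \<subseteq> {..n} - {z} \<and> card p = 2" if p: "p \<in> P" for p
    proof -
      obtain i j where ij: "(i, j) \<in> E" "p = {\<tau> (i, j), \<tau> (j, i)}" using p unfolding P_def by blast
      then show ?thesis using E[OF ij(1)] zL by (auto simp: z_def \<tau>_eq \<tau>n)
    qed
    show "pairwise disjnt P"
    proof (rule pairwiseI)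
      fix p q assume pq: "p \<in> P" "q \<in> P" "p \<noteq> q"
      obtain i j where ij: "(i, j) \<in> E" "p = {\<tau> (i, j), \<tau> (j, i)}" using pq unfolding P_def by blast
      obtain i' j' where ij': "(i', j') \<in> E" "q = {\<tau> (i', j'), \<tau> (j', i')}" using pq unfolding P_def by blast
      show "disjnt p q"
        using E[OF ij(1)] E[OF ij'(1)] pq(3) unfolding ij(2) ij'(2) by (auto simp: disjnt_def \<tau>_eq)
    qed
  next
    fix S assume S: "S \<subseteq> {..n}" "card S \<le> 3"
    have finS: "finite S" using S finite_subset by blast
    show "cfun.dependent (\<alpha> ` S) \<longleftrightarrow> S \<in> insert z ` P"
    proof
      assume "cfun.dependent (\<alpha> ` S)"
      then obtain u where u: "\<exists>a\<in>\<alpha> ` S. u a \<noteq> 0" "(\<Sum>a\<in>\<alpha> ` S. cscale (u a) a) = 0"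
        using finS by (auto simp: cfun.dependent_finite)
      \<comment> \<open>Restricting to the support makes all coefficients nonzero; \<open>v\<close>
        absorbs the scalars \<open>c\<close>, so that the relation becomes one between labelled
        forms.\<close>
      define R where "R = {m \<in> S. u (\<alpha> m) \<noteq> 0}"
      define v where "v e = u (\<alpha> (\<tau> e)) * c (\<tau> e)" for e
      have R: "R \<subseteq> S" "R \<noteq> {}" "finite R" using u finS by (auto simp: R_def)
      have Rn: "m \<le> n" if "m \<in> R" for m using that R S by auto
      have inj\<sigma>: "inj_on \<sigma> R" using bij\<sigma> Rn by (auto simp: bij_betw_def inj_on_def)
      have "\<exists>i j. (i, j) \<in> ?L \<and> i \<noteq> j \<and> \<sigma> ` R = {(0, 0), (i, j), (j, i)}"
      proof (rule semiorder_form_relation[of _ l v])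
        show "\<sigma> ` R \<subseteq> ?L" using \<sigma>c Rn by auto
        show "\<sigma> ` R \<noteq> {}" "finite (\<sigma> ` R)" using R by auto
        show "card (\<sigma> ` R) \<le> 3"
          using card_image_le[of R \<sigma>] card_mono[OF finS R(1)] R S by linarith
        show "v e \<noteq> 0" if e: "e \<in> \<sigma> ` R" for e
        proof -
          obtain m where m: "m \<in> R" "e = \<sigma> m" using e by blast
          have "c m \<noteq> 0" using \<sigma>c Rn[OF m(1)] by blast
          then show ?thesis using m \<tau>\<sigma>[OF Rn[OF m(1)]] by (simp add: v_def R_def)
        qed
        fix k
        have "(\<Sum>e\<in>\<sigma> ` R. v e * semiorder_form e k) = (\<Sum>m\<in>R. v (\<sigma> m) * semiorder_form (\<sigma> m) k)"
          using inj\<sigma> by (simp add: sum.reindex)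
        also have "\<dots> = (\<Sum>m\<in>R. u (\<alpha> m) * \<alpha> m k)"
        proof (rule sum.cong[OF refl])
          fix m assume "m \<in> R"
          then have m: "m \<le> n" by (rule Rn)
          have "\<alpha> m k = c m * semiorder_form (\<sigma> m) k"
            using \<sigma>c[OF m] unfolding cscale_def by metis
          then show "v (\<sigma> m) * semiorder_form (\<sigma> m) k = u (\<alpha> m) * \<alpha> m k"
            using \<tau>\<sigma>[OF m] by (simp add: v_def)
        qed
        also have "\<dots> = (\<Sum>m\<in>S. u (\<alpha> m) * \<alpha> m k)"
          using finS by (intro sum.mono_neutral_left) (auto simp: R_def)
        also have "\<dots> = (\<Sum>m\<in>S. cscale (u (\<alpha> m)) (\<alpha> m)) k" by (simp add: sum_cscale_apply)
        also have "\<dots> = (\<Sum>a\<in>\<alpha> ` S. cscale (u a) a) k"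
          using inj_on_subset[OF inj\<alpha> S(1)] by (simp add: sum.reindex)
        finally show "(\<Sum>e\<in>\<sigma> ` R. v e * semiorder_form e k) = 0" using u(2) by simp
      qed
      then obtain i j where ij: "(i, j) \<in> ?L" "i \<noteq> j" and \<sigma>R: "\<sigma> ` R = {(0, 0), (i, j), (j, i)}"
        by blast
      have "R = \<tau> ` \<sigma> ` R" using \<tau>\<sigma> Rn by force
      then have Req: "R = insert z {\<tau> (i, j), \<tau> (j, i)}" by (simp add: \<sigma>R z_def)
      \<comment> \<open>The support already has three elements, as many as \<open>S\<close> can
        have, so it is all of \<open>S\<close>.\<close>
      have "card R = 3"
        using card_image[OF inj\<sigma>] ij unfolding \<sigma>R by (auto simp: semiorder_labels_def)
      then have "S = R" using card_seteq[OF finS R(1)] S by simp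
      moreover have "{\<tau> (i, j), \<tau> (j, i)} \<in> P" using ij by (auto simp: P_def E_def)
      ultimately show "S \<in> insert z ` P" using Req by blast
    next
      assume "S \<in> insert z ` P"
      then obtain i j where ij: "(i, j) \<in> E" and Seq: "S = {z, \<tau> (i, j), \<tau> (j, i)}"
        unfolding P_def by blast
      note L = E[OF ij]
      let ?a = "\<tau> (i, j)" and ?b = "\<tau> (j, i)"
      \<comment> \<open>Dependence is shown by removing \<open>\<alpha> z\<close> from the image, so
        the two other vectors must differ from it in order to remain.\<close>
      have ne: "\<alpha> z \<noteq> \<alpha> ?a" "\<alpha> z \<noteq> \<alpha> ?b"
        using inj\<alpha> L zL \<tau>_eq \<tau>n unfolding z_def by (auto dest!: inj_onD)
      have form: "semiorder_form e = cscale (1 / c (\<tau> e)) (\<alpha> (\<tau> e))" if "e \<in> ?L" for e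
        using \<sigma>c[OF \<tau>n[OF that]] \<sigma>\<tau>[OF that] by (metis cfun.scale_scale cfun.scale_one nonzero_divide_eq_eq)
      have "\<alpha> z = cscale (c z) (semiorder_form (0, 0))"
        using \<sigma>c[OF \<tau>n[OF zL]] \<sigma>\<tau>[OF zL] by (simp add: z_def)
      \<comment> \<open>The forms with labels \<open>(i, j)\<close> and \<open>(j, i)\<close> add up
        to \<open>-2 x\<^sub>0\<close>, and the label \<open>(0, 0)\<close> stands for
        \<open>- x\<^sub>0\<close>.\<close>
      also have "semiorder_form (0, 0) = cscale (1/2) (semiorder_form (i, j) + semiorder_form (j, i))"
        using L by (auto simp: semiorder_form_def cscale_def)
      also have "cscale (c z) \<dots> \<in> cfun.span {\<alpha> ?a, \<alpha> ?b}"
        unfolding form[OF L(1)] form[OF L(2)]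
        by (intro cfun.span_scale cfun.span_add cfun.span_base) auto
      also have "{\<alpha> ?a, \<alpha> ?b} = \<alpha> ` S - {\<alpha> z}" using ne by (auto simp: Seq)
      finally show "cfun.dependent (\<alpha> ` S)" unfolding cfun.dependent_def by (auto simp: Seq)
    qed
  qed
  also have "\<Union>P = {..n} - {z}"
  proof -
    have sym: "(j, i) \<in> E" if "(i, j) \<in> E" for i j using E[OF that] by (auto simp: E_def)
    have "\<Union>P = \<tau> ` E"
    proof (intro equalityI subsetI)
      fix x assume "x \<in> \<Union>P"
      then obtain i j where ij: "(i, j) \<in> E" "x \<in> {\<tau> (i, j), \<tau> (j, i)}"
        unfolding P_def by blast
      then show "x \<in> \<tau> ` E" using sym[OF ij(1)] by blast
    next
      fix x assume "x \<in> \<tau> ` E"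
      then obtain i j where ij: "(i, j) \<in> E" "x = \<tau> (i, j)" by auto
      then have "{\<tau> (i, j), \<tau> (j, i)} \<in> P" unfolding P_def by blast
      then show "x \<in> \<Union>P" using ij(2) by blast
    qed
    also have "E = ?L - {(0, 0)}" by (auto simp: E_def semiorder_labels_def)
    also have "\<tau> ` (?L - {(0, 0)}) = {..n} - {z}"
      using bij\<tau> zL inj_on_image_set_diff[of \<tau> ?L ?L "{(0, 0)}"] by (simp add: bij_betw_def z_def)
    finally show ?thesis .
  qed
  also have "card ({..n} - {z}) = n" using \<tau>n[OF zL] by (simp add: z_def)
  \<comment> \<open>The indices start at 0, so there are \<open>Suc n\<close> of them; this matches
    the extra label \<open>(0, 0)\<close> in the count of labels.\<close>
  also have "n = l * (l - 1)"
    using bij_betw_same_card[OF bij\<sigma>] by (simp add: card_semiorder_labels)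
  finally show ?thesis .
qed

end
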